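(* Let $0<\alpha<1$, $1<\beta<2$, $e_1,e_2>0$, $L,T>0$. For each integer $N\ge 3$ let $M=M_N\ge2$ be an integer (the number of time steps, allowed to depend on $N$), let $h=L/N$, $\tau=T/M_N$, and let $A_0$ and $P_{sk}$ be the $(N-1)\times(N-1)$ matrices defined in the context. Suppose $\hat v$ is a real number with $0<\hat v<h^\beta c_0^{(\alpha,\sigma)}$ (for every $N$ considered). Then for any $\varepsilon>0$ there exists an integer $N'>0$ such that for all $N$ with $N-1>N'$, $$P_{sk}^{-1}A_0-I=U+V,$$ where $U,V$ are $(N-1)\times(N-1)$ matrices with $\operatorname{rank}(U)<2N'$ and $\|V\|_2\le\frac{\varepsilon}{\hat v}$.
   Context: Put $\sigma=1-\alpha/2$. Define $g_0^{(\beta)}=1$, $g_k^{(\beta)}=\left(1-\frac{\beta+1}{k}\right)g_{k-1}^{(\beta)}$ for $k\ge1$; $\omega_0^{(\beta)}=\frac{\beta}{2}g_0^{(\beta)}$, $\omega_k^{(\beta)}=\frac{\beta}{2}g_k^{(\beta)}+\frac{2-\beta}{2}g_{k-1}^{(\beta)}$ for $k\ge1$. $G_\beta\in\mathbb{R}^{(N-1)\times(N-1)}$ is the Toeplitz matrix with $[G_\beta]_{ij}=\omega_{i-j+1}^{(\beta)}$ if $i-j\ge-1$ and $0$ otherwise; $K_N=e_1G_\beta+e_2G_\beta^T$. $sk(G_\beta)\in\mathbb{R}^{(N-1)\times(N-1)}$ is the skew-circulant Toeplitz matrix with first column $\left[\omega_1^{(\beta)},\omega_2^{(\beta)},\dots,\omega_{N-2}^{(\beta)},-\omega_0^{(\beta)}\right]^T$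 and first row $\left[\omega_1^{(\beta)},\omega_0^{(\beta)},-\omega_{N-2}^{(\beta)},-\omega_{N-3}^{(\beta)},\dots,-\omega_2^{(\beta)}\right]$; $sk(K_N)=e_1\,sk(G_\beta)+e_2\,sk(G_\beta)^T$. With $a_0=\sigma^{1-\alpha}$ and $b_1=\frac{1}{2-\alpha}\left[(1+\sigma)^{2-\alpha}-\sigma^{2-\alpha}\right]-\frac12\left[(1+\sigma)^{1-\alpha}-\sigma^{1-\alpha}\right]$, set $c_0^{(\alpha,\sigma)}=\frac{\tau^{-\alpha}}{\Gamma(2-\alpha)}(a_0+b_1)$. $A_0=h^\beta c_0^{(\alpha,\sigma)}I-\sigma K_N$ and $P_{sk}=h^\beta c_0^{(\alpha,\sigma)}I-\sigma\, sk(K_N)$. The matrix $P_{sk}$ is invertible. $\|\cdot\|_2$ is the spectral norm. *)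

theory Defs
  imports
    "HOL-Analysis.L2_Norm"
    "HOL-Analysis.Gamma_Function"
    "Jordan_Normal_Form.DL_Rank"
begin

text \<open>Matrices are Jordan Normal Form matrices, whose indices start at 0; all matrices below
  have size \<open>N - 1\<close>. Only index differences occur in their entries, so the shift from
  1-based indices changes nothing.\<close>

fun g :: "real \<Rightarrow> nat \<Rightarrow> real" where
  "g \<beta> 0 = 1"
| "g \<beta> (Suc k) = (1 - (\<beta> + 1) / real (Suc k)) * g \<beta> k"

fun \<omega> :: "real \<Rightarrow> nat \<Rightarrow> real" where
  "\<omega> \<beta> 0 = \<beta> / 2 * g \<beta> 0"
| "\<omega> \<beta> (Suc k) = \<beta> / 2 * g \<beta> (Suc k) + (2 - \<beta>) / 2 * g \<beta> k"

text \<open>The side condition \<open>j \<le> i + 1\<close> is \<open>i - j \<ge> -1\<close>, and makes the natural-number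
  subtraction exact.\<close>

definition G_mat :: "real \<Rightarrow> nat \<Rightarrow> real mat" where
  "G_mat \<beta> N = mat (N - 1) (N - 1) (\<lambda>(i, j). if j \<le> i + 1 then \<omega> \<beta> (i + 1 - j) else 0)"

definition K_mat :: "real \<Rightarrow> real \<Rightarrow> real \<Rightarrow> nat \<Rightarrow> real mat" where
  "K_mat \<beta> e1 e2 N = e1 \<cdot>\<^sub>m G_mat \<beta> N + e2 \<cdot>\<^sub>m transpose_mat (G_mat \<beta> N)"

definition toeplitz_mat :: "real list \<Rightarrow> real list \<Rightarrow> real mat" where
  "toeplitz_mat c r = mat (length c) (length r) (\<lambda>(i, j). if j \<le> i then c ! (i - j) else r ! (j - i))"

text \<open>For \<open>N \<ge> 3\<close> both lists have length \<open>N - 1\<close>. The tail of the first row is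
  \<open>-\<omega>(N - 2), -\<omega>(N - 3), \<dots>, -\<omega>(2)\<close>, which is empty for \<open>N = 3\<close>.\<close>

definition sk_G_mat :: "real \<Rightarrow> nat \<Rightarrow> real mat" where
  "sk_G_mat \<beta> N = toeplitz_mat
     (map (\<omega> \<beta>) [1..<N - 1] @ [- \<omega> \<beta> 0])
     ([\<omega> \<beta> 1, \<omega> \<beta> 0] @ map (\<lambda>k. - \<omega> \<beta> k) (rev [2..<N - 1]))"

definition sk_K_mat :: "real \<Rightarrow> real \<Rightarrow> real \<Rightarrow> nat \<Rightarrow> real mat" where
  "sk_K_mat \<beta> e1 e2 N = e1 \<cdot>\<^sub>m sk_G_mat \<beta> N + e2 \<cdot>\<^sub>m transpose_mat (sk_G_mat \<beta> N)"

definition sigma :: "real \<Rightarrow> real" where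
  "sigma \<alpha> = 1 - \<alpha> / 2"

definition a0 :: "real \<Rightarrow> real" where
  "a0 \<alpha> = sigma \<alpha> powr (1 - \<alpha>)"

definition b1 :: "real \<Rightarrow> real" where
  "b1 \<alpha> = 1 / (2 - \<alpha>) * ((1 + sigma \<alpha>) powr (2 - \<alpha>) - sigma \<alpha> powr (2 - \<alpha>))
         - 1 / 2 * ((1 + sigma \<alpha>) powr (1 - \<alpha>) - sigma \<alpha> powr (1 - \<alpha>))"

definition c0 :: "real \<Rightarrow> real \<Rightarrow> real" where
  "c0 \<alpha> \<tau> = \<tau> powr (- \<alpha>) / Gamma (2 - \<alpha>) * (a0 \<alpha> + b1 \<alpha>)"

definition A0_mat :: "real \<Rightarrow> real \<Rightarrow> real \<Rightarrow> real \<Rightarrow> real \<Rightarrow> real \<Rightarrow> nat \<Rightarrow> real mat" where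
  "A0_mat \<alpha> \<beta> e1 e2 h \<tau> N =
     (h powr \<beta> * c0 \<alpha> \<tau>) \<cdot>\<^sub>m 1\<^sub>m (N - 1) - sigma \<alpha> \<cdot>\<^sub>m K_mat \<beta> e1 e2 N"

definition P_sk_mat :: "real \<Rightarrow> real \<Rightarrow> real \<Rightarrow> real \<Rightarrow> real \<Rightarrow> real \<Rightarrow> nat \<Rightarrow> real mat" where
  "P_sk_mat \<alpha> \<beta> e1 e2 h \<tau> N =
     (h powr \<beta> * c0 \<alpha> \<tau>) \<cdot>\<^sub>m 1\<^sub>m (N - 1) - sigma \<alpha> \<cdot>\<^sub>m sk_K_mat \<beta> e1 e2 N"

definition euclidean_norm :: "real vec \<Rightarrow> real" where
  "euclidean_norm x = L2_set (vec_index x) {..<dim_vec x}"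

text \<open>The operator norm induced by the Euclidean norm. Taking the closed unit ball rather than the
  unit sphere keeps the supremum over a nonempty set in dimension 0.\<close>

definition spectral_norm :: "real mat \<Rightarrow> real" where
  "spectral_norm A =
     Sup {euclidean_norm (A *\<^sub>v x) | x. x \<in> carrier_vec (dim_col A) \<and> euclidean_norm x \<le> 1}"

end

theory Submission
  imports Defs
begin

text \<open>Write \<open>n = N - 1\<close>, \<open>A\<close> for the coefficient matrix, \<open>P\<close> for the preconditioner and \<open>\<mu>\<close> for
  \<open>h powr \<beta> * c0 \<alpha> \<tau>\<close>, the factor of the identity in both. Since \<open>P\<inverse> A - I = P\<inverse> (A - P)\<close>, two facts suffice.

  \<^item> The inverse of \<open>P\<close> has spectral norm at most \<open>1 / \<mu> < 1 / v\<close>, uniformly in \<open>N\<close>. A skew-circulant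
    matrix acts on a vector as a convolution of antiperiodic sequences, so the quadratic form of
    \<open>sk_G_mat\<close> is \<open>\<Sum>k<n. \<omega> k * R (1 - k)\<close>, where \<open>R\<close> is the autocorrelation of the antiperiodic
    extension of the vector. As \<open>R\<close> is even and bounded above by \<open>R 0\<close>, and as \<open>\<omega> 0 + \<omega> 2\<close> and
    all \<open>\<omega> k\<close> with \<open>k \<ge> 3\<close> are nonnegative, the form is at most \<open>(\<Sum>k<n. \<omega> k) * R 0\<close>, and the sum
    of at least three leading \<open>\<omega> k\<close> is nonpositive (\<open>sk_G_quadratic_form_nonpos\<close>). Hence the quadratic form of \<open>P\<close>
    dominates \<open>\<mu>\<close> times the squared norm, which makes \<open>P\<close> invertible with the stated bound
    (\<open>coercive_inverse\<close>).

  \<^item> The entries of \<open>sk_G_mat - G_mat\<close> concentrate in two opposite corners: apart from the bottom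
    left one, the entry at \<open>(i, j)\<close> is nonzero only for \<open>j \<ge> i + 2\<close>, where it is
    \<open>- \<omega> (n + 1 + i - j)\<close>. In a row \<open>i\<close> with \<open>m \<le> i < n - m\<close>, both this matrix and its transpose
    therefore only contain coefficients of index at least \<open>m\<close>, each at most once per row and per
    column. The \<open>\<omega> k\<close> are absolutely summable, so for large \<open>m\<close>, independent of \<open>N\<close>, these rows form a
    matrix with small absolute row and column sums, hence with small spectral norm (\<open>schur_test\<close>).
    The remaining rows, at most \<open>2 * m\<close> of them, form a matrix of rank at most \<open>2 * m\<close>.

  Multiplying both parts by \<open>P\<inverse>\<close> yields \<open>V\<close> and \<open>U\<close> (\<open>preconditioned_splitting\<close>).\<close>

section \<open>Signs and summability of the coefficients\<close>

lemma g_nonneg: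
  assumes "1 < \<beta>" "\<beta> < 2" "k \<ge> 2"
  shows "g \<beta> k \<ge> 0"
  using assms(3)
proof (induction k rule: dec_induct)
  case base
  have "g \<beta> 2 = \<beta> * (\<beta> - 1) / 2"
    by (simp add: numeral_2_eq_2 field_simps)
  then show ?case using assms(1) by (simp only: mult_nonneg_nonneg divide_nonneg_pos)
next
  case (step k)
  have "1 - (\<beta> + 1) / real (Suc k) \<ge> 0"
    using step(1) assms by (simp add: field_simps)
  with step(3) show ?case by (simp del: of_nat_Suc)
qed

text \<open>The generating function of \<open>g \<beta>\<close> is \<open>(1 - x) powr \<beta>\<close>, so its partial sums are the
  coefficients of \<open>(1 - x) powr (\<beta> - 1)\<close>. Expressing them through the next coefficient gives
  their sign at once.\<close>

lemma sum_g:
  assumes "\<beta> \<noteq> 0"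
  shows "(\<Sum>k\<le>m. g \<beta> k) = - real (Suc m) * g \<beta> (Suc m) / \<beta>"
proof (induction m)
  case 0
  then show ?case using assms by (simp add: field_simps)
next
  case (Suc m)
  have *: "real (Suc (Suc m)) * g \<beta> (Suc (Suc m)) = (real (Suc (Suc m)) - (\<beta> + 1)) * g \<beta> (Suc m)"
    by (simp add: field_simps del: of_nat_Suc)
  have "(\<Sum>k\<le>Suc m. g \<beta> k) = - ((real (Suc (Suc m)) - (\<beta> + 1)) * g \<beta> (Suc m)) / \<beta>"
    using assms by (simp add: Suc field_simps del: g.simps)
  then show ?case unfolding *[symmetric] by (simp only: minus_mult_left)
qed

lemma sum_g_nonpos:
  assumes "1 < \<beta>" "\<beta> < 2" "m \<ge> 1"
  shows "(\<Sum>k\<le>m. g \<beta> k) \<le> 0"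
  using g_nonneg[of \<beta> "Suc m"] assms
  by (subst sum_g) (auto intro!: divide_nonpos_pos mult_nonpos_nonneg simp del: g.simps)

lemma sum_\<omega>:
  "(\<Sum>k\<le>Suc m. \<omega> \<beta> k) = \<beta> / 2 * (\<Sum>k\<le>Suc m. g \<beta> k) + (2 - \<beta>) / 2 * (\<Sum>k\<le>m. g \<beta> k)"
  by (induction m) (simp_all add: distrib_left del: g.simps(2))

lemma sum_\<omega>_nonpos:
  assumes "1 < \<beta>" "\<beta> < 2" "m \<ge> 2"
  shows "(\<Sum>k\<le>m. \<omega> \<beta> k) \<le> 0"
proof -
  obtain m' where m': "m = Suc m'" "m' \<ge> 1" using assms(3) by (cases m) auto
  show ?thesis unfolding m'(1) sum_\<omega>
    using sum_g_nonpos[OF assms(1,2), of m'] sum_g_nonpos[OF assms(1,2), of "Suc m'"] assms(1,2) m'(2)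
    by (intro add_nonpos_nonpos mult_nonneg_nonpos) (simp_all del: g.simps sum.atMost_Suc)
qed

text \<open>The coefficient \<open>\<omega> \<beta> 2\<close> is negative for \<open>\<beta>\<close> near 1, which is why the index starts at 3 here
  and \<open>\<omega> \<beta> 2\<close> is paired with \<open>\<omega> \<beta> 0\<close> below.\<close>

lemma \<omega>_nonneg:
  assumes "1 < \<beta>" "\<beta> < 2" "k \<ge> 3"
  shows "\<omega> \<beta> k \<ge> 0"
proof -
  obtain k' where "k = Suc k'" "k' \<ge> 2" using assms(3) by (cases k) auto
  then show ?thesis using assms g_nonneg[of \<beta>] by (simp del: g.simps)
qed

lemma \<omega>_0_2_nonneg:
  assumes "1 < \<beta>" "\<beta> < 2"
  shows "\<omega> \<beta> 0 + \<omega> \<beta> 2 \<ge> 0"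
proof -
  have "\<omega> \<beta> 0 + \<omega> \<beta> 2 = \<beta> / 4 * ((\<beta> + 2) * (\<beta> - 1))"
    by (simp add: numeral_2_eq_2 field_simps)
  also have "\<dots> \<ge> 0" using assms by simp
  finally show ?thesis .
qed

text \<open>All but three terms are nonnegative, and the nonpositive full partial sums bound the partial
  sums of these terms from above.\<close>

lemma summable_\<omega>:
  assumes "1 < \<beta>" "\<beta> < 2"
  shows "summable (\<lambda>k. \<bar>\<omega> \<beta> k\<bar>)"
proof -
  have "summable (\<lambda>k. \<omega> \<beta> (k + 3))"
  proof (rule summableI_nonneg_bounded[where x = "- (\<Sum>k<3. \<omega> \<beta> k)"])
    fix m
    have "(\<Sum>k<m. \<omega> \<beta> (k + 3)) + (\<Sum>k<3. \<omega> \<beta> k) = (\<Sum>k<m + 3. \<omega> \<beta> k)"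
    proof (induction m)
      case (Suc m)
      have "{..<Suc m + 3} = insert (m + 3) {..<m + 3}" by auto
      with Suc show ?case by (simp del: \<omega>.simps)
    qed simp
    also have "\<dots> = (\<Sum>k\<le>m + 2. \<omega> \<beta> k)"
      by (rule sum.cong) auto
    also have "\<dots> \<le> 0" using assms by (intro sum_\<omega>_nonpos) auto
    finally show "(\<Sum>k<m. \<omega> \<beta> (k + 3)) \<le> - (\<Sum>k<3. \<omega> \<beta> k)" by simp
  qed (use \<omega>_nonneg assms in auto)
  moreover have "(\<lambda>k. \<omega> \<beta> (k + 3)) = (\<lambda>k. \<bar>\<omega> \<beta> (k + 3)\<bar>)"
    using \<omega>_nonneg[OF assms] by (auto simp del: \<omega>.simps)
  ultimately show ?thesis using summable_iff_shift[of "\<lambda>k. \<bar>\<omega> \<beta> k\<bar>" 3] by simp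
qed

text \<open>The tail of a row or column of a Toeplitz matrix is a sum over an arbitrary finite set of
  indices, so the Cauchy criterion is put in that form.\<close>

lemma finite_tail_small:
  fixes f :: "nat \<Rightarrow> real"
  assumes "summable (\<lambda>k. \<bar>f k\<bar>)" "\<delta> > 0"
  obtains m where "\<And>S. finite S \<Longrightarrow> S \<subseteq> {m..} \<Longrightarrow> (\<Sum>k\<in>S. \<bar>f k\<bar>) \<le> \<delta>"
proof -
  obtain m where m: "\<And>a b. m \<le> a \<Longrightarrow> norm (\<Sum>k\<in>{a..<b}. \<bar>f k\<bar>) < \<delta>"
    using assms unfolding summable_Cauchy by blast
  have "(\<Sum>k\<in>S. \<bar>f k\<bar>) \<le> \<delta>" if "finite S" "S \<subseteq> {m..}" for S
  proof -
    have "(\<Sum>k\<in>S. \<bar>f k\<bar>) \<le> (\<Sum>k\<in>{m..<Suc (Max S)}. \<bar>f k\<bar>)"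
      using that by (intro sum_mono2) (auto simp: less_Suc_eq_le)
    also have "\<dots> \<le> norm (\<Sum>k\<in>{m..<Suc (Max S)}. \<bar>f k\<bar>)" by simp
    also have "\<dots> < \<delta>" by (rule m) simp
    finally show ?thesis by simp
  qed
  with that show thesis by blast
qed

section \<open>Antiperiodic sequences and autocorrelation\<close>

definition antiperiodic :: "nat \<Rightarrow> (nat \<Rightarrow> real) \<Rightarrow> int \<Rightarrow> real" where
  "antiperiodic n f d =
     (if even (d div int n) then 1 else - 1) * f (nat (d mod int n))"

lemma antiperiodic_nat: "k < n \<Longrightarrow> antiperiodic n f (int k) = f k"
  by (simp add: antiperiodic_def)

lemma antiperiodic_shift:
  assumes "n > 0"
  shows "antiperiodic n f (d + int n) = - antiperiodic n f d"
  using assms by (simp add: antiperiodic_def)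

lemma antiperiodic_diff:
  assumes "k < n"
  shows "antiperiodic n f (int k - int n) = - f k"
  using antiperiodic_shift[of n f "int k - int n"] antiperiodic_nat[OF assms, of f] assms by simp

lemma periodic_mod:
  fixes p :: "int \<Rightarrow> real"
  assumes per: "\<And>d. p (d + int n) = p d"
  shows "p (d mod int n) = p d"
proof -
  have *: "p (d + int n * int q) = p d" for d q
  proof (induction q)
    case (Suc q)
    have "p (d + int n * int (Suc q)) = p ((d + int n * int q) + int n)"
      by (simp add: algebra_simps)
    then show ?case using per Suc by simp
  qed simp
  have **: "p (d + int n * q) = p d" for d q
  proof (cases "q \<ge> 0")
    case True then show ?thesis using *[of d "nat q"] by simp
  next
    case False then show ?thesis using *[of "d + int n * q" "nat (- q)"] by simp
  qed
  show ?thesis using **[of "d mod int n" "d div int n"] by simp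
qed

text \<open>The indices \<open>a + s * i\<close> run through every residue class modulo \<open>n\<close> exactly once. With
  \<open>s = 1\<close> this is a shift of a cyclic sum, with \<open>s = - 1\<close> a reflection.\<close>

lemma sum_periodic_affine:
  fixes p :: "int \<Rightarrow> real"
  assumes n: "n > 0" and per: "\<And>d. p (d + int n) = p d" and s: "s = 1 \<or> s = - 1"
  shows "(\<Sum>i<n. p (a + s * int i)) = (\<Sum>i<n. p (int i))"
proof -
  let ?\<phi> = "\<lambda>i. nat ((a + s * int i) mod int n)"
  have inj: "inj_on ?\<phi> {..<n}"
  proof (rule inj_onI)
    fix i j assume ij: "i \<in> {..<n}" "j \<in> {..<n}" "?\<phi> i = ?\<phi> j"
    then have "(a + s * int i) mod int n = (a + s * int j) mod int n"
      using n by (simp add: nat_eq_iff)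
    then have "int n dvd s * (int i - int j)"
      by (simp add: mod_eq_dvd_iff algebra_simps)
    then have "int n dvd (int i - int j)" using s by (auto simp: dvd_diff_commute)
    moreover have "\<bar>int i - int j\<bar> < int n" using ij by auto
    ultimately show "i = j" using zdvd_imp_le[of "int n" "\<bar>int i - int j\<bar>"] by fastforce
  qed
  have sub: "?\<phi> ` {..<n} \<subseteq> {..<n}" using n by (auto simp: nat_less_iff)
  have "bij_betw ?\<phi> {..<n} {..<n}"
    unfolding bij_betw_def using inj endo_inj_surj[OF _ sub inj] by blast
  then have "(\<Sum>i<n. p (int i)) = (\<Sum>i<n. p (int (?\<phi> i)))"
    by (rule sum.reindex_bij_betw[symmetric])
  also have "\<dots> = (\<Sum>i<n. p (a + s * int i))"
  proof (intro sum.cong refl)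
    fix i
    have "int (?\<phi> i) = (a + s * int i) mod int n" using n by simp
    then show "p (int (?\<phi> i)) = p (a + s * int i)" using periodic_mod[of p n, OF per] by metis
  qed
  finally show ?thesis by simp
qed

text \<open>For an antiperiodic \<open>y\<close> the products below are periodic in \<open>i\<close>, and the value at \<open>d\<close> is the
  inner product of a vector with its \<open>d\<close>-fold skew-cyclic shift.\<close>

definition autocorrelation :: "nat \<Rightarrow> (int \<Rightarrow> real) \<Rightarrow> int \<Rightarrow> real" where
  "autocorrelation n y d = (\<Sum>i<n. y (int i) * y (int i + d))"

lemma autocorrelation_minus:
  assumes n: "n > 0" and y: "\<And>d. y (d + int n) = - y d"
  shows "autocorrelation n y (- d) = autocorrelation n y d"
proof -
  let ?p = "\<lambda>k. y k * y (k - d)"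
  have "?p (k + int n) = ?p k" for k
    using y[of k] y[of "k - d"] by (simp add: algebra_simps)
  from sum_periodic_affine[of n ?p 1 d, OF n this]
  show ?thesis by (simp add: autocorrelation_def mult.commute add.commute)
qed

text \<open>A skew-cyclic shift preserves the sum of squares, so this is the arithmetic-geometric mean
  inequality applied to each product.\<close>

lemma autocorrelation_le:
  assumes n: "n > 0" and y: "\<And>d. y (d + int n) = - y d"
  shows "autocorrelation n y d \<le> autocorrelation n y 0"
proof -
  let ?q = "\<lambda>k. y k * y k"
  have "?q (k + int n) = ?q k" for k using y[of k] by simp
  from sum_periodic_affine[of n ?q 1 d, OF n this]
  have shift: "(\<Sum>i<n. ?q (int i + d)) = (\<Sum>i<n. ?q (int i))" by (simp add: add.commute)
  have "a * b \<le> (a * a + b * b) / 2" for a b :: real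
    using sum_squares_ge_zero[of "a - b" 0] by (simp add: algebra_simps)
  then have "autocorrelation n y d \<le> (\<Sum>i<n. (?q (int i) + ?q (int i + d)) / 2)"
    unfolding autocorrelation_def by (intro sum_mono)
  also have "\<dots> = (\<Sum>i<n. ?q (int i))"
    using shift by (simp add: sum.distrib flip: sum_divide_distrib)
  finally show ?thesis by (simp add: autocorrelation_def)
qed

section \<open>The skew-circulant matrix\<close>

text \<open>A skew-circulant matrix is a Toeplitz matrix whose symbol is antiperiodic. Here the symbol is
  \<open>\<omega> \<beta>\<close>, shifted by 1 because the coefficient of index 0 lies on the superdiagonal.\<close>

lemma sk_G_entry:
  assumes n: "n \<ge> 2" and i: "i < n" and j: "j < n"
  shows "sk_G_mat \<beta> (Suc n) $$ (i, j) = antiperiodic n (\<omega> \<beta>) (int i + 1 - int j)"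
proof -
  let ?r = "[\<omega> \<beta> 1, \<omega> \<beta> 0] @ map (\<lambda>k. - \<omega> \<beta> k) (rev [2..<n])"
  have entry: "sk_G_mat \<beta> (Suc n) $$ (i, j) =
      (if j \<le> i then (map (\<omega> \<beta>) [1..<n] @ [- \<omega> \<beta> 0]) ! (i - j) else ?r ! (j - i))"
    using assms by (simp add: sk_G_mat_def toeplitz_mat_def)
  consider "j \<le> i" "i - j < n - 1" | "i - j = n - 1" "j \<le> i" | "j = i + 1" | "j \<ge> i + 2" using i by linarith
  then show ?thesis
  proof cases
    case 1
    then have "int i + 1 - int j = int (i + 1 - j)" by simp
    moreover have "i + 1 - j < n" using 1 by simp
    ultimately have "antiperiodic n (\<omega> \<beta>) (int i + 1 - int j) = \<omega> \<beta> (i + 1 - j)"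
      by (simp only: antiperiodic_nat)
    then show ?thesis using entry 1 by (simp add: nth_append Suc_diff_le del: \<omega>.simps)
  next
    case 2
    then have "int i + 1 - int j = 0 + int n" using n by simp
    then have "antiperiodic n (\<omega> \<beta>) (int i + 1 - int j) = - \<omega> \<beta> 0"
      using antiperiodic_shift[of n "\<omega> \<beta>" 0] antiperiodic_nat[of 0 n "\<omega> \<beta>"] n
      by (simp del: \<omega>.simps)
    then show ?thesis using entry 2 by (simp add: nth_append del: \<omega>.simps)
  next
    case 3
    then show ?thesis using entry n antiperiodic_nat[of 0 n "\<omega> \<beta>"] by (simp del: \<omega>.simps)
  next
    case 4
    define k where "k = n + 1 - (j - i)"
    have k: "k < n" "int i + 1 - int j = int k - int n" using 4 j by (auto simp: k_def)
    then have "antiperiodic n (\<omega> \<beta>) (int i + 1 - int j) = - \<omega> \<beta> k"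
      by (simp only: antiperiodic_diff)
    moreover have "?r ! (j - i) = - \<omega> \<beta> k"
    proof -
      define q where "q = j - i - 2"
      have q: "j - i = Suc (Suc q)" "q < n - 2" "k = n - Suc q"
        using 4 j by (auto simp: q_def k_def)
      have "[2..<n] ! (n - 2 - Suc q) = k" using q by (subst nth_upt) auto
      then show ?thesis using q(1,2) by (simp add: rev_nth del: \<omega>.simps upt_Suc)
    qed
    ultimately show ?thesis using entry 4 by (simp del: \<omega>.simps)
  qed
qed

text \<open>Rewriting each row as a cyclic convolution turns the form into a combination of
  autocorrelations. The shifts by \<open>1\<close> and \<open>- 1\<close> have the same autocorrelation, which merges the terms
  of index 0 and 2 into one with a nonnegative coefficient; only index 1, whose shift is 0, keeps a
  negative coefficient.\<close>

lemma sk_G_quadratic_form_nonpos: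
  assumes \<beta>: "1 < \<beta>" "\<beta> < 2" and n: "n \<ge> 3"
  shows "(\<Sum>i<n. \<Sum>j<n. sk_G_mat \<beta> (Suc n) $$ (i, j) * x i * x j) \<le> 0"
proof -
  define w y where "w = antiperiodic n (\<omega> \<beta>)" and "y = antiperiodic n x"
  have n0: "n > 0" using n by simp
  have w: "w (d + int n) = - w d" and y: "y (d + int n) = - y d" for d
    unfolding w_def y_def using antiperiodic_shift[OF n0] by auto
  define R where "R = autocorrelation n y"
  have row: "(\<Sum>j<n. w (int i + 1 - int j) * y (int j))
      = (\<Sum>k<n. \<omega> \<beta> k * y (int i + (1 - int k)))" for i
  proof -
    let ?p = "\<lambda>k. w k * y (int i + 1 - k)"
    have "?p (k + int n) = ?p k" for k
      using w[of k] y[of "int i + 1 - (k + int n)"] by (simp add: algebra_simps)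
    from sum_periodic_affine[of n ?p "-1" "int i + 1", OF n0 this]
    have "(\<Sum>j<n. w (int i + 1 - int j) * y (int j)) = (\<Sum>k<n. w (int k) * y (int i + 1 - int k))"
      by simp
    also have "\<dots> = (\<Sum>k<n. \<omega> \<beta> k * y (int i + (1 - int k)))"
      by (intro sum.cong) (auto simp: w_def antiperiodic_nat algebra_simps)
    finally show ?thesis .
  qed
  have "(\<Sum>i<n. \<Sum>j<n. sk_G_mat \<beta> (Suc n) $$ (i, j) * x i * x j)
      = (\<Sum>i<n. y (int i) * (\<Sum>j<n. w (int i + 1 - int j) * y (int j)))"
    using n by (auto simp: sk_G_entry w_def y_def antiperiodic_nat sum_distrib_left mult_ac
        simp del: \<omega>.simps intro!: sum.cong)
  also have "\<dots> = (\<Sum>i<n. \<Sum>k<n. \<omega> \<beta> k * (y (int i) * y (int i + (1 - int k))))"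
    unfolding row by (simp add: sum_distrib_left mult_ac)
  also have "\<dots> = (\<Sum>k<n. \<omega> \<beta> k * R (1 - int k))"
    unfolding R_def autocorrelation_def by (subst sum.swap) (simp add: sum_distrib_left)
  also have "\<dots> = (\<Sum>k\<in>{..<3}. \<omega> \<beta> k * R (1 - int k)) + (\<Sum>k\<in>{3..<n}. \<omega> \<beta> k * R (1 - int k))"
    using n by (subst sum.union_disjoint[symmetric]) (auto intro: sum.cong)
  also have "(\<Sum>k\<in>{..<3}. \<omega> \<beta> k * R (1 - int k)) = (\<omega> \<beta> 0 + \<omega> \<beta> 2) * R 1 + \<omega> \<beta> 1 * R 0"
    using autocorrelation_minus[where y = y and d = 1, OF n0 y]
    by (simp add: R_def eval_nat_numeral algebra_simps del: \<omega>.simps)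
  also have "\<dots> \<le> (\<omega> \<beta> 0 + \<omega> \<beta> 2) * R 0 + \<omega> \<beta> 1 * R 0"
    using \<omega>_0_2_nonneg[OF \<beta>] autocorrelation_le[where y = y, OF n0 y]
    by (intro add_right_mono mult_left_mono) (auto simp: R_def simp del: \<omega>.simps)
  also have "(\<Sum>k\<in>{3..<n}. \<omega> \<beta> k * R (1 - int k)) \<le> (\<Sum>k\<in>{3..<n}. \<omega> \<beta> k * R 0)"
    using \<omega>_nonneg[OF \<beta>] autocorrelation_le[where y = y, OF n0 y]
    by (intro sum_mono mult_left_mono) (auto simp: R_def)
  also have "(\<omega> \<beta> 0 + \<omega> \<beta> 2) * R 0 + \<omega> \<beta> 1 * R 0 + (\<Sum>k\<in>{3..<n}. \<omega> \<beta> k * R 0)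
      = ((\<Sum>k\<in>{..<3}. \<omega> \<beta> k) + (\<Sum>k\<in>{3..<n}. \<omega> \<beta> k)) * R 0"
    by (simp add: eval_nat_numeral distrib_right sum_distrib_right del: \<omega>.simps)
  also have "(\<Sum>k\<in>{..<3}. \<omega> \<beta> k) + (\<Sum>k\<in>{3..<n}. \<omega> \<beta> k) = (\<Sum>k\<le>n - 1. \<omega> \<beta> k)"
  proof -
    have "{..n - 1} = {..<3} \<union> {3..<n}" using n by auto
    moreover have "{..<3} \<inter> {3..<n} = {}" by auto
    ultimately show ?thesis by (simp only: sum.union_disjoint finite_lessThan finite_atLeastLessThan)
  qed
  also have "\<dots> * R 0 \<le> 0"
    using sum_\<omega>_nonpos[OF \<beta>, of "n - 1"] n
    by (intro mult_nonpos_nonneg) (auto simp: R_def autocorrelation_def intro: sum_nonneg)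
  finally show ?thesis by simp
qed

section \<open>Spectral norm, rank and coercive matrices\<close>

lemma euclidean_norm_nonneg: "euclidean_norm x \<ge> 0"
  by (simp add: euclidean_norm_def)

lemma euclidean_norm_sq: "(euclidean_norm x)\<^sup>2 = (\<Sum>i<dim_vec x. (x $ i)\<^sup>2)"
  by (simp add: euclidean_norm_def L2_set_def sum_nonneg)

lemma mult_mat_vec_entry:
  assumes "A \<in> carrier_mat m n" "x \<in> carrier_vec n" "i < m"
  shows "(A *\<^sub>v x) $ i = (\<Sum>j<n. A $$ (i, j) * x $ j)"
  using assms by (auto simp: scalar_prod_def atLeast0LessThan)

text \<open>The Cauchy-Schwarz inequality with weights \<open>\<bar>A $$ (i, j)\<bar>\<close> bounds each squared entry of
  \<open>A *\<^sub>v x\<close> by the absolute row sum times a weighted sum of squares; summing over the rows then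
  produces the absolute column sums.\<close>

lemma schur_test:
  fixes A :: "real mat"
  assumes A: "A \<in> carrier_mat m n" and x: "x \<in> carrier_vec n" and C: "C \<ge> 0"
    and rows: "\<And>i. i < m \<Longrightarrow> (\<Sum>j<n. \<bar>A $$ (i, j)\<bar>) \<le> C"
    and cols: "\<And>j. j < n \<Longrightarrow> (\<Sum>i<m. \<bar>A $$ (i, j)\<bar>) \<le> C"
  shows "euclidean_norm (A *\<^sub>v x) \<le> C * euclidean_norm x"
proof -
  have row: "((A *\<^sub>v x) $ i)\<^sup>2 \<le> C * (\<Sum>j<n. \<bar>A $$ (i, j)\<bar> * (x $ j)\<^sup>2)" if i: "i < m" for i
  proof -
    let ?a = "\<lambda>j. \<bar>A $$ (i, j)\<bar>"
    have "\<bar>(A *\<^sub>v x) $ i\<bar> \<le> (\<Sum>j<n. \<bar>A $$ (i, j) * x $ j\<bar>)"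
      unfolding mult_mat_vec_entry[OF A x i] by (rule sum_abs)
    also have "\<dots> = (\<Sum>j<n. \<bar>sqrt (?a j)\<bar> * \<bar>sqrt (?a j) * x $ j\<bar>)"
      by (intro sum.cong) (auto simp: abs_mult mult.assoc[symmetric])
    also have "\<dots> \<le> L2_set (\<lambda>j. sqrt (?a j)) {..<n} * L2_set (\<lambda>j. sqrt (?a j) * x $ j) {..<n}"
      by (rule L2_set_mult_ineq)
    finally have "\<bar>(A *\<^sub>v x) $ i\<bar>\<^sup>2
        \<le> (L2_set (\<lambda>j. sqrt (?a j)) {..<n} * L2_set (\<lambda>j. sqrt (?a j) * x $ j) {..<n})\<^sup>2"
      by (intro power_mono) auto
    also have "\<dots> = (\<Sum>j<n. ?a j) * (\<Sum>j<n. ?a j * (x $ j)\<^sup>2)"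
      by (simp add: L2_set_def power_mult_distrib sum_nonneg)
    also have "\<dots> \<le> C * (\<Sum>j<n. ?a j * (x $ j)\<^sup>2)"
      using rows[OF i] by (intro mult_right_mono sum_nonneg) auto
    finally show ?thesis by (simp only: power2_abs)
  qed
  have "(euclidean_norm (A *\<^sub>v x))\<^sup>2 = (\<Sum>i<m. ((A *\<^sub>v x) $ i)\<^sup>2)"
    using A by (simp add: euclidean_norm_sq)
  also have "\<dots> \<le> (\<Sum>i<m. C * (\<Sum>j<n. \<bar>A $$ (i, j)\<bar> * (x $ j)\<^sup>2))"
    using row by (intro sum_mono) auto
  also have "\<dots> = C * (\<Sum>j<n. (\<Sum>i<m. \<bar>A $$ (i, j)\<bar>) * (x $ j)\<^sup>2)"
    unfolding sum_distrib_left[symmetric] sum_distrib_right by (subst sum.swap) (rule refl)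
  also have "\<dots> \<le> C * (\<Sum>j<n. C * (x $ j)\<^sup>2)"
    using cols C by (intro mult_left_mono sum_mono mult_right_mono) auto
  also have "\<dots> = (C * euclidean_norm x)\<^sup>2"
    by (simp only: power_mult_distrib euclidean_norm_sq carrier_vecD[OF x] power2_eq_square[of C]
        mult.assoc sum_distrib_left[symmetric])
  finally show ?thesis
    by (rule power2_le_imp_le) (intro mult_nonneg_nonneg C euclidean_norm_nonneg)
qed

lemma spectral_norm_le:
  assumes "\<And>x. x \<in> carrier_vec (dim_col A) \<Longrightarrow> euclidean_norm (A *\<^sub>v x) \<le> C * euclidean_norm x"
    and "C \<ge> 0"
  shows "spectral_norm A \<le> C"
  unfolding spectral_norm_def
proof (rule cSup_least)
  have "euclidean_norm (0\<^sub>v (dim_col A)) \<le> 1"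
    by (simp add: euclidean_norm_def L2_set_def)
  then show "{euclidean_norm (A *\<^sub>v x) | x. x \<in> carrier_vec (dim_col A) \<and> euclidean_norm x \<le> 1} \<noteq> {}"
    using zero_carrier_vec by blast
next
  fix r assume "r \<in> {euclidean_norm (A *\<^sub>v x) | x. x \<in> carrier_vec (dim_col A) \<and> euclidean_norm x \<le> 1}"
  then obtain x where x: "r = euclidean_norm (A *\<^sub>v x)" "x \<in> carrier_vec (dim_col A)" "euclidean_norm x \<le> 1"
    by blast
  have "r \<le> C * euclidean_norm x" using assms(1) x by simp
  also have "\<dots> \<le> C" using x(3) assms(2) by (simp add: mult_left_le)
  finally show "r \<le> C" .
qed

text \<open>The matrix is a sum of \<open>card S\<close> outer products, each of rank at most 1.\<close>

lemma rank_sum_of_products_le: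
  fixes A :: "real mat"
  assumes "finite S" "A \<in> carrier_mat m n"
    and "\<And>r c. r < m \<Longrightarrow> c < n \<Longrightarrow> A $$ (r, c) = (\<Sum>k\<in>S. u k r * w k c)"
  shows "vec_space.rank m A \<le> card S"
  using assms
proof (induction S arbitrary: A rule: finite_induct)
  case empty
  then have "A = 0\<^sub>m m n" by (intro eq_matI) auto
  then show ?case by (simp add: vec_space.rank_0I)
next
  case (insert k S)
  define A1 A2 where "A1 = mat m n (\<lambda>(r, c). u k r * w k c)"
    and "A2 = mat m n (\<lambda>(r, c). \<Sum>k\<in>S. u k r * w k c)"
  have c: "A1 \<in> carrier_mat m n" "A2 \<in> carrier_mat m n" by (auto simp: A1_def A2_def)
  have "A = A1 + A2"
    using insert by (intro eq_matI) (auto simp: A1_def A2_def)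
  moreover have "vec_space.rank m A1 \<le> 1"
    by (rule vec_space.rank_le_1_product_entries[OF c(1)]) (auto simp: A1_def)
  moreover have "vec_space.rank m A2 \<le> card S"
    by (rule insert.IH[OF c(2)]) (auto simp: A2_def)
  ultimately show ?case
    using vec_space.rank_subadditive[OF c] insert by simp
qed

text \<open>By Cauchy-Schwarz the hypothesis implies \<open>\<mu> * euclidean_norm x \<le> euclidean_norm (P *\<^sub>v x)\<close>. So
  the kernel of \<open>P\<close> is trivial, and the same inequality at \<open>Q *\<^sub>v x\<close> bounds the inverse.\<close>

lemma coercive_inverse:
  fixes P :: "real mat"
  assumes P: "P \<in> carrier_mat n n" and \<mu>: "\<mu> > 0"
    and coercive: "\<And>x. \<mu> * (\<Sum>i<n. (x i)\<^sup>2) \<le> (\<Sum>i<n. \<Sum>j<n. P $$ (i, j) * x i * x j)"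
  obtains Q where "Q \<in> carrier_mat n n" "P * Q = 1\<^sub>m n" "Q * P = 1\<^sub>m n"
    "\<And>x. x \<in> carrier_vec n \<Longrightarrow> euclidean_norm (Q *\<^sub>v x) \<le> euclidean_norm x / \<mu>"
proof -
  have bound: "\<mu> * euclidean_norm x \<le> euclidean_norm (P *\<^sub>v x)" if x: "x \<in> carrier_vec n" for x
  proof (cases "euclidean_norm x = 0")
    case True
    then show ?thesis by (simp add: euclidean_norm_nonneg)
  next
    case False
    have "euclidean_norm x * (\<mu> * euclidean_norm x) = \<mu> * (\<Sum>i<n. (x $ i)\<^sup>2)"
      using euclidean_norm_sq[of x] x by (simp add: power2_eq_square)
    also have "\<dots> \<le> (\<Sum>i<n. \<Sum>j<n. P $$ (i, j) * x $ i * x $ j)" by (rule coercive)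
    also have "\<dots> = (\<Sum>i<n. x $ i * (P *\<^sub>v x) $ i)"
      by (intro sum.cong refl)
        (simp add: mult_mat_vec_entry[OF P x] sum_distrib_left mult_ac)
    also have "\<dots> \<le> (\<Sum>i<n. \<bar>x $ i\<bar> * \<bar>(P *\<^sub>v x) $ i\<bar>)"
      by (intro sum_mono) (simp flip: abs_mult)
    also have "\<dots> \<le> euclidean_norm x * euclidean_norm (P *\<^sub>v x)"
      using L2_set_mult_ineq[of "vec_index x" "vec_index (P *\<^sub>v x)" "{..<n}"] x P
      by (simp add: euclidean_norm_def)
    finally show ?thesis
      using False euclidean_norm_nonneg[of x] by simp
  qed
  have "det P \<noteq> 0"
  proof
    assume "det P = 0"
    then obtain x where x: "x \<in> carrier_vec n" "x \<noteq> 0\<^sub>v n" "P *\<^sub>v x = 0\<^sub>v n"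
      using det_0_iff_vec_prod_zero_field[OF P] by blast
    have "\<mu> * euclidean_norm x \<le> euclidean_norm (0\<^sub>v n)" using bound[OF x(1)] x(3) by simp
    also have "\<dots> = 0" by (simp add: euclidean_norm_def L2_set_def)
    finally have "euclidean_norm x = 0"
      using \<mu> euclidean_norm_nonneg[of x] by (simp add: mult_le_0_iff)
    then have "\<forall>i<n. x $ i = 0"
      using x(1) by (simp add: euclidean_norm_def L2_set_eq_0_iff)
    then have "x = 0\<^sub>v n" using x(1) by (intro eq_vecI) auto
    with x(2) show False by simp
  qed
  from det_non_zero_imp_unit[OF P this, of "()"]
  obtain Q where Q: "Q \<in> carrier_mat n n" "P * Q = 1\<^sub>m n" "Q * P = 1\<^sub>m n"
    by (auto simp: Units_def ring_mat_def)
  show thesis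
  proof (rule that[OF Q])
    fix x :: "real vec" assume x: "x \<in> carrier_vec n"
    have "P *\<^sub>v (Q *\<^sub>v x) = x"
      using assoc_mult_mat_vec[OF P Q(1) x] Q(2) x by simp
    moreover have "Q *\<^sub>v x \<in> carrier_vec n" using Q(1) x by simp
    ultimately have "\<mu> * euclidean_norm (Q *\<^sub>v x) \<le> euclidean_norm x"
      using bound by metis
    then show "euclidean_norm (Q *\<^sub>v x) \<le> euclidean_norm x / \<mu>"
      using \<mu> by (simp add: field_simps)
  qed
qed

text \<open>The rows of \<open>A - P\<close> indexed by \<open>S\<close> contribute the low-rank part: their product with the inverse
  of \<open>P\<close> is a sum of \<open>card S\<close> outer products of a column of the inverse with a row of \<open>A - P\<close>. The
  other rows contribute the small part.\<close>

lemma preconditioned_splitting: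
  fixes P A :: "real mat"
  assumes P: "P \<in> carrier_mat n n" and A: "A \<in> carrier_mat n n" and \<mu>: "\<mu> > 0"
    and coercive: "\<And>x. \<mu> * (\<Sum>i<n. (x i)\<^sup>2) \<le> (\<Sum>i<n. \<Sum>j<n. P $$ (i, j) * x i * x j)"
    and S: "S \<subseteq> {..<n}" and C: "C \<ge> 0"
    and rows: "\<And>i. i < n \<Longrightarrow> i \<notin> S \<Longrightarrow> (\<Sum>j<n. \<bar>A $$ (i, j) - P $$ (i, j)\<bar>) \<le> C"
    and cols: "\<And>j. j < n \<Longrightarrow> (\<Sum>i\<in>{..<n} - S. \<bar>A $$ (i, j) - P $$ (i, j)\<bar>) \<le> C"
  obtains Q U V where "Q \<in> carrier_mat n n" "P * Q = 1\<^sub>m n" "Q * P = 1\<^sub>m n"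
    "U \<in> carrier_mat n n" "V \<in> carrier_mat n n" "Q * A - 1\<^sub>m n = U + V"
    "vec_space.rank n U \<le> card S" "spectral_norm V \<le> C / \<mu>"
proof -
  obtain Q where Q: "Q \<in> carrier_mat n n" "P * Q = 1\<^sub>m n" "Q * P = 1\<^sub>m n"
    and Q_bound: "\<And>x. x \<in> carrier_vec n \<Longrightarrow> euclidean_norm (Q *\<^sub>v x) \<le> euclidean_norm x / \<mu>"
    using coercive_inverse[OF P \<mu> coercive] by blast
  define E where "E = (\<lambda>i j. A $$ (i, j) - P $$ (i, j))"
  define E1 E2 where "E1 = mat n n (\<lambda>(i, j). if i \<in> S then E i j else 0)"
    and "E2 = mat n n (\<lambda>(i, j). if i \<in> S then 0 else E i j)"
  have E1: "E1 \<in> carrier_mat n n" and E2: "E2 \<in> carrier_mat n n" by (auto simp: E1_def E2_def)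
  have "A = P + (E1 + E2)"
    using A P by (intro eq_matI) (auto simp: E1_def E2_def E_def)
  then have "Q * A = Q * P + Q * (E1 + E2)"
    using Q(1) P E1 E2 by (simp add: mult_add_distrib_mat)
  also have "Q * (E1 + E2) = Q * E1 + Q * E2"
    using Q(1) E1 E2 by (simp add: mult_add_distrib_mat)
  finally have split: "Q * A - 1\<^sub>m n = Q * E1 + Q * E2"
    using Q(1,3) E1 E2 by (intro eq_matI) auto
  have "vec_space.rank n (Q * E1) \<le> card S"
  proof (rule rank_sum_of_products_le[where u = "\<lambda>k r. Q $$ (r, k)" and w = E])
    fix r c assume rc: "r < n" "c < n"
    have "(Q * E1) $$ (r, c) = (\<Sum>k<n. Q $$ (r, k) * E1 $$ (k, c))"
      using Q(1) E1 rc by (auto simp: scalar_prod_def atLeast0LessThan)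
    also have "\<dots> = (\<Sum>k\<in>S. Q $$ (r, k) * E k c)"
      using S rc by (intro sum.mono_neutral_cong_right) (auto simp: E1_def)
    finally show "(Q * E1) $$ (r, c) = (\<Sum>k\<in>S. Q $$ (r, k) * E k c)" .
  qed (use Q(1) E1 S finite_subset in auto)
  moreover have "spectral_norm (Q * E2) \<le> C / \<mu>"
  proof (rule spectral_norm_le)
    fix x :: "real vec" assume "x \<in> carrier_vec (dim_col (Q * E2))"
    then have x: "x \<in> carrier_vec n" using E2 by simp
    have "euclidean_norm (E2 *\<^sub>v x) \<le> C * euclidean_norm x"
    proof (rule schur_test[OF E2 x C])
      fix i assume "i < n"
      then show "(\<Sum>j<n. \<bar>E2 $$ (i, j)\<bar>) \<le> C"
        using rows[of i] C by (cases "i \<in> S") (auto simp: E2_def E_def)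
    next
      fix j assume j: "j < n"
      have "(\<Sum>i<n. \<bar>E2 $$ (i, j)\<bar>) = (\<Sum>i\<in>{..<n} - S. \<bar>E i j\<bar>)"
        using j by (intro sum.mono_neutral_cong_right) (auto simp: E2_def)
      then show "(\<Sum>i<n. \<bar>E2 $$ (i, j)\<bar>) \<le> C" using cols[OF j] by (simp add: E_def)
    qed
    moreover have "euclidean_norm (Q * E2 *\<^sub>v x) \<le> euclidean_norm (E2 *\<^sub>v x) / \<mu>"
      using assoc_mult_mat_vec[OF Q(1) E2 x] Q_bound[of "E2 *\<^sub>v x"] E2 x by simp
    ultimately show "euclidean_norm (Q * E2 *\<^sub>v x) \<le> C / \<mu> * euclidean_norm x"
      using \<mu> by (simp add: field_simps)
  qed (use C \<mu> in auto)
  ultimately show thesis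
    using that[OF Q, of "Q * E1" "Q * E2"] split Q(1) E1 E2 by simp
qed

section \<open>The preconditioner and its distance from the coefficient matrix\<close>

lemma G_carrier: "G_mat \<beta> (Suc n) \<in> carrier_mat n n"
  by (simp add: G_mat_def)

lemma sk_G_carrier: "n \<ge> 2 \<Longrightarrow> sk_G_mat \<beta> (Suc n) \<in> carrier_mat n n"
  by (auto simp: sk_G_mat_def toeplitz_mat_def)

lemma A0_carrier: "A0_mat \<alpha> \<beta> e1 e2 h \<tau> (Suc n) \<in> carrier_mat n n"
  unfolding A0_mat_def K_mat_def diff_Suc_1
  by (intro minus_carrier_mat smult_carrier_mat add_carrier_mat) (simp add: G_carrier)

lemma P_sk_carrier: "n \<ge> 2 \<Longrightarrow> P_sk_mat \<alpha> \<beta> e1 e2 h \<tau> (Suc n) \<in> carrier_mat n n"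
  unfolding P_sk_mat_def sk_K_mat_def diff_Suc_1
  by (intro minus_carrier_mat smult_carrier_mat add_carrier_mat) (simp add: sk_G_carrier)

lemma P_sk_entry:
  assumes "n \<ge> 2" "i < n" "j < n"
  shows "P_sk_mat \<alpha> \<beta> e1 e2 h \<tau> (Suc n) $$ (i, j) =
    (if i = j then h powr \<beta> * c0 \<alpha> \<tau> else 0)
    - sigma \<alpha> * (e1 * sk_G_mat \<beta> (Suc n) $$ (i, j) + e2 * sk_G_mat \<beta> (Suc n) $$ (j, i))"
  using assms carrier_matD[OF sk_G_carrier[OF assms(1), of \<beta>]]
  by (simp add: P_sk_mat_def sk_K_mat_def del: \<omega>.simps)

lemma A0_minus_P_sk_entry:
  assumes "n \<ge> 2" "i < n" "j < n"
  shows "A0_mat \<alpha> \<beta> e1 e2 h \<tau> (Suc n) $$ (i, j) - P_sk_mat \<alpha> \<beta> e1 e2 h \<tau> (Suc n) $$ (i, j) =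
    sigma \<alpha> * (e1 * (sk_G_mat \<beta> (Suc n) $$ (i, j) - G_mat \<beta> (Suc n) $$ (i, j))
             + e2 * (sk_G_mat \<beta> (Suc n) $$ (j, i) - G_mat \<beta> (Suc n) $$ (j, i)))"
  unfolding P_sk_entry[OF assms]
  using assms carrier_matD[OF G_carrier[of \<beta> n]]
  by (simp add: A0_mat_def K_mat_def right_diff_distrib distrib_left del: \<omega>.simps)

text \<open>A matrix and its transpose have the same quadratic form, so that of \<open>sk_K_mat\<close> is
  \<open>e1 + e2\<close> times that of \<open>sk_G_mat\<close> and hence nonpositive.\<close>

lemma P_sk_coercive:
  assumes \<beta>: "1 < \<beta>" "\<beta> < 2" and n: "n \<ge> 3" and e: "e1 \<ge> 0" "e2 \<ge> 0" and \<sigma>: "sigma \<alpha> \<ge> 0"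
  shows "h powr \<beta> * c0 \<alpha> \<tau> * (\<Sum>i<n. (x i)\<^sup>2)
    \<le> (\<Sum>i<n. \<Sum>j<n. P_sk_mat \<alpha> \<beta> e1 e2 h \<tau> (Suc n) $$ (i, j) * x i * x j)"
proof -
  define \<mu> where "\<mu> = h powr \<beta> * c0 \<alpha> \<tau>"
  define q where "q = (\<lambda>i j. sk_G_mat \<beta> (Suc n) $$ (i, j) * x i * x j)"
  define F where "F = (\<Sum>i<n. \<Sum>j<n. q i j)"
  have F: "F \<le> 0" unfolding F_def q_def by (rule sk_G_quadratic_form_nonpos[OF \<beta> n])
  have "(\<Sum>i<n. \<Sum>j<n. P_sk_mat \<alpha> \<beta> e1 e2 h \<tau> (Suc n) $$ (i, j) * x i * x j)
      = (\<Sum>i<n. \<Sum>j<n. (if i = j then \<mu> * (x i)\<^sup>2 else 0) - sigma \<alpha> * (e1 * q i j + e2 * q j i))"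
    using n by (intro sum.cong refl) (auto simp: P_sk_entry q_def \<mu>_def power2_eq_square algebra_simps)
  also have "\<dots> = \<mu> * (\<Sum>i<n. (x i)\<^sup>2) - sigma \<alpha> * (e1 * F + e2 * (\<Sum>i<n. \<Sum>j<n. q j i))"
    by (simp add: sum_subtractf sum.distrib F_def flip: sum_distrib_left)
  also have "(\<Sum>i<n. \<Sum>j<n. q j i) = F" unfolding F_def by (rule sum.swap)
  also have "\<mu> * (\<Sum>i<n. (x i)\<^sup>2) \<le> \<mu> * (\<Sum>i<n. (x i)\<^sup>2) - sigma \<alpha> * (e1 * F + e2 * F)"
    using mult_nonneg_nonpos[OF \<sigma>, of "e1 * F + e2 * F"] mult_nonneg_nonpos[OF e(1) F]
      mult_nonneg_nonpos[OF e(2) F] by simp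
  finally show ?thesis by (simp add: \<mu>_def)
qed

text \<open>On and below the superdiagonal both matrices have the symbol \<open>\<omega> \<beta>\<close>. The excluded position is
  the bottom left corner, where \<open>G_mat\<close> has \<open>\<omega> \<beta> n\<close> but the antiperiodic symbol has already changed
  sign and equals \<open>- \<omega> \<beta> 0\<close>.\<close>

lemma sk_G_minus_G_entry:
  assumes n: "n \<ge> 2" and i: "i < n" and j: "j < n" and corner: "\<not> (i = n - 1 \<and> j = 0)"
  shows "\<bar>sk_G_mat \<beta> (Suc n) $$ (i, j) - G_mat \<beta> (Suc n) $$ (i, j)\<bar> =
    (if i + 2 \<le> j then \<bar>\<omega> \<beta> (n + 1 + i - j)\<bar> else 0)"
proof (cases "i + 2 \<le> j")
  case True
  then have "int i + 1 - int j = int (n + 1 + i - j) - int n" "n + 1 + i - j < n" using j by auto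
  then have "sk_G_mat \<beta> (Suc n) $$ (i, j) = - \<omega> \<beta> (n + 1 + i - j)"
    unfolding sk_G_entry[OF n i j] by (simp only: antiperiodic_diff)
  moreover have "G_mat \<beta> (Suc n) $$ (i, j) = 0" using True i j by (simp add: G_mat_def)
  ultimately show ?thesis using True by simp
next
  case False
  then have "int i + 1 - int j = int (i + 1 - j)" "i + 1 - j < n" using i j corner by auto
  then have "sk_G_mat \<beta> (Suc n) $$ (i, j) = \<omega> \<beta> (i + 1 - j)"
    unfolding sk_G_entry[OF n i j] by (simp only: antiperiodic_nat)
  moreover have "G_mat \<beta> (Suc n) $$ (i, j) = \<omega> \<beta> (i + 1 - j)" using False i j by (simp add: G_mat_def)
  ultimately show ?thesis using False by simp
qed

lemma sum_tail_if_le: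
  fixes f :: "nat \<Rightarrow> real"
  assumes tail: "\<And>S. finite S \<Longrightarrow> S \<subseteq> {m..} \<Longrightarrow> (\<Sum>k\<in>S. \<bar>f k\<bar>) \<le> \<delta>"
    and "finite J" "inj_on \<phi> {j \<in> J. R j}" "\<And>j. j \<in> J \<Longrightarrow> R j \<Longrightarrow> m \<le> \<phi> j"
  shows "(\<Sum>j\<in>J. if R j then \<bar>f (\<phi> j)\<bar> else 0) \<le> \<delta>"
proof -
  have "(\<Sum>j\<in>J. if R j then \<bar>f (\<phi> j)\<bar> else 0) = (\<Sum>j\<in>{j \<in> J. R j}. \<bar>f (\<phi> j)\<bar>)"
    using assms(2) by (simp add: sum.inter_filter)
  also have "\<dots> = (\<Sum>k\<in>\<phi> ` {j \<in> J. R j}. \<bar>f k\<bar>)"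
    using assms(3) by (simp add: sum.reindex)
  also have "\<dots> \<le> \<delta>" using assms(2,4) by (intro tail) auto
  finally show ?thesis .
qed

text \<open>In the rows \<open>m \<le> i < n - m\<close> the index \<open>n + 1 + i - j\<close> is at least \<open>i + 2 > m\<close>, and the
  transposed index \<open>n + 1 + j - i\<close> is greater than \<open>m\<close>. Along a fixed row or column each index occurs
  once, so every sum is bounded by the tail of the series.\<close>

lemma A0_minus_P_sk_bounds:
  fixes \<alpha> \<beta> e1 e2 h \<tau> \<delta> :: real
  assumes e: "e1 \<ge> 0" "e2 \<ge> 0" and \<sigma>: "0 \<le> sigma \<alpha>" "sigma \<alpha> \<le> 1"
    and m: "m \<ge> 1" and n: "n \<ge> 2"
    and tail: "\<And>S. finite S \<Longrightarrow> S \<subseteq> {m..} \<Longrightarrow> (\<Sum>k\<in>S. \<bar>\<omega> \<beta> k\<bar>) \<le> \<delta>"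
  defines "D \<equiv> \<lambda>i j. A0_mat \<alpha> \<beta> e1 e2 h \<tau> (Suc n) $$ (i, j) - P_sk_mat \<alpha> \<beta> e1 e2 h \<tau> (Suc n) $$ (i, j)"
  shows "m \<le> i \<Longrightarrow> i < n - m \<Longrightarrow> (\<Sum>j<n. \<bar>D i j\<bar>) \<le> (e1 + e2) * \<delta>"
    and "j < n \<Longrightarrow> (\<Sum>i\<in>{m..<n - m}. \<bar>D i j\<bar>) \<le> (e1 + e2) * \<delta>"
proof -
  define t where "t = (\<lambda>i j. if i + 2 \<le> j then \<bar>\<omega> \<beta> (n + 1 + i - j)\<bar> else 0)"
  have D: "\<bar>D i j\<bar> \<le> e1 * t i j + e2 * t j i" if "m \<le> i" "i < n - m" "j < n" for i j
  proof -
    let ?d = "\<lambda>i j. sk_G_mat \<beta> (Suc n) $$ (i, j) - G_mat \<beta> (Suc n) $$ (i, j)"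
    have "i < n" "\<not> (i = n - 1 \<and> j = 0)" "\<not> (j = n - 1 \<and> i = 0)"
      using that m by linarith+
    then have d: "\<bar>?d i j\<bar> = t i j" "\<bar>?d j i\<bar> = t j i"
      using sk_G_minus_G_entry[of n i j \<beta>] sk_G_minus_G_entry[of n j i \<beta>] n that(3)
      unfolding t_def by blast+
    have "\<bar>D i j\<bar> = sigma \<alpha> * \<bar>e1 * ?d i j + e2 * ?d j i\<bar>"
      using that n \<sigma> by (simp add: D_def A0_minus_P_sk_entry abs_mult)
    also have "\<dots> \<le> \<bar>e1 * ?d i j + e2 * ?d j i\<bar>"
      using \<sigma> by (simp add: mult_left_le_one_le)
    also have "\<dots> \<le> \<bar>e1 * ?d i j\<bar> + \<bar>e2 * ?d j i\<bar>" by (rule abs_triangle_ineq)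
    also have "\<dots> = e1 * t i j + e2 * t j i" using e d by (simp add: abs_mult)
    finally show ?thesis .
  qed
  have sum_D: "(\<Sum>(i, j)\<in>I. \<bar>D i j\<bar>) \<le> (e1 + e2) * \<delta>"
    if "\<And>i j. (i, j) \<in> I \<Longrightarrow> m \<le> i \<and> i < n - m \<and> j < n"
      and "(\<Sum>(i, j)\<in>I. t i j) \<le> \<delta>" "(\<Sum>(i, j)\<in>I. t j i) \<le> \<delta>" for I
  proof -
    have "(\<Sum>(i, j)\<in>I. \<bar>D i j\<bar>) \<le> (\<Sum>(i, j)\<in>I. e1 * t i j + e2 * t j i)"
      using that(1) D by (intro sum_mono) auto
    also have "\<dots> = e1 * (\<Sum>(i, j)\<in>I. t i j) + e2 * (\<Sum>(i, j)\<in>I. t j i)"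
      by (simp add: sum.distrib sum_distrib_left case_prod_unfold)
    also have "\<dots> \<le> e1 * \<delta> + e2 * \<delta>"
      using that e by (intro add_mono mult_left_mono)
    finally show ?thesis by (simp add: distrib_right)
  qed
  have tail_if: "(\<Sum>j\<in>J. if R j then \<bar>\<omega> \<beta> (\<phi> j)\<bar> else 0) \<le> \<delta>"
    if J: "finite J" "inj_on \<phi> {j \<in> J. R j}" "\<And>j. j \<in> J \<Longrightarrow> R j \<Longrightarrow> m \<le> \<phi> j"
    for J :: "nat set" and R and \<phi> :: "nat \<Rightarrow> nat"
  proof (rule sum_tail_if_le[where m = m])
    show "(\<Sum>k\<in>S. \<bar>\<omega> \<beta> k\<bar>) \<le> \<delta>" if "finite S" "S \<subseteq> {m..}" for S
      using that by (rule tail)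
    show "finite J" by (rule J(1))
    show "inj_on \<phi> {j \<in> J. R j}" by (rule J(2))
    show "m \<le> \<phi> j" if "j \<in> J" "R j" for j using that by (rule J(3))
  qed
  show "(\<Sum>j<n. \<bar>D i j\<bar>) \<le> (e1 + e2) * \<delta>" if i: "m \<le> i" "i < n - m"
  proof -
    have I: "(\<Sum>(k, j)\<in>Pair i ` {..<n}. F k j) = (\<Sum>j<n. F i j)" for F :: "nat \<Rightarrow> nat \<Rightarrow> real"
      by (simp add: sum.reindex inj_on_def)
    have "(\<Sum>(k, j)\<in>Pair i ` {..<n}. \<bar>D k j\<bar>) \<le> (e1 + e2) * \<delta>"
    proof (rule sum_D)
      show "(\<Sum>(k, j)\<in>Pair i ` {..<n}. t k j) \<le> \<delta>"
        unfolding I t_def by (rule tail_if) (use i in \<open>auto intro: inj_onI\<close>)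
      show "(\<Sum>(k, j)\<in>Pair i ` {..<n}. t j k) \<le> \<delta>"
        unfolding I t_def by (rule tail_if) (use i in \<open>auto intro: inj_onI\<close>)
    qed (use i in auto)
    then show ?thesis unfolding I .
  qed
  show "(\<Sum>i\<in>{m..<n - m}. \<bar>D i j\<bar>) \<le> (e1 + e2) * \<delta>" if j: "j < n"
  proof -
    have I: "(\<Sum>(i, k)\<in>(\<lambda>i. (i, j)) ` {m..<n - m}. F i k) = (\<Sum>i\<in>{m..<n - m}. F i j)"
      for F :: "nat \<Rightarrow> nat \<Rightarrow> real"
      by (simp add: sum.reindex inj_on_def)
    have "(\<Sum>(i, k)\<in>(\<lambda>i. (i, j)) ` {m..<n - m}. \<bar>D i k\<bar>) \<le> (e1 + e2) * \<delta>"
    proof (rule sum_D)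
      show "(\<Sum>(i, k)\<in>(\<lambda>i. (i, j)) ` {m..<n - m}. t i k) \<le> \<delta>"
        unfolding I t_def by (rule tail_if) (use j in \<open>auto intro: inj_onI\<close>)
      show "(\<Sum>(i, k)\<in>(\<lambda>i. (i, j)) ` {m..<n - m}. t k i) \<le> \<delta>"
        unfolding I t_def by (rule tail_if) (use j in \<open>auto intro: inj_onI\<close>)
    qed (use j in auto)
    then show ?thesis unfolding I .
  qed
qed

theorem theorem3p4:
  fixes \<alpha> \<beta> e1 e2 L T v \<epsilon> :: real
    and M :: "nat \<Rightarrow> nat"
  assumes "0 < \<alpha>" and "\<alpha> < 1"
    and "1 < \<beta>" and "\<beta> < 2"
    and "e1 > 0" and "e2 > 0"
    and "L > 0" and "T > 0"
    and "\<And>N. N \<ge> 3 \<Longrightarrow> M N \<ge> 2"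
    and "0 < v"
    and "\<And>N. N \<ge> 3 \<Longrightarrow> v < (L / real N) powr \<beta> * c0 \<alpha> (T / real (M N))"
    and "\<epsilon> > 0"
  shows "\<exists>N'::nat. N' > 0 \<and>
    (\<forall>N\<ge>3. N - 1 > N' \<longrightarrow>
      (let h = L / real N;
           \<tau> = T / real (M N);
           A0 = A0_mat \<alpha> \<beta> e1 e2 h \<tau> N;
           P = P_sk_mat \<alpha> \<beta> e1 e2 h \<tau> N
       in \<exists>Pinv U V.
            Pinv \<in> carrier_mat (N - 1) (N - 1) \<and> inverts_mat P Pinv \<and> inverts_mat Pinv P \<and>
            U \<in> carrier_mat (N - 1) (N - 1) \<and> V \<in> carrier_mat (N - 1) (N - 1) \<and>
            Pinv * A0 - 1\<^sub>m (N - 1) = U + V \<and>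
            vec_space.rank (N - 1) U < 2 * N' \<and>
            spectral_norm V \<le> \<epsilon> / v))"
proof -
  have \<sigma>: "0 \<le> sigma \<alpha>" "sigma \<alpha> \<le> 1" using assms(1,2) by (auto simp: sigma_def)
  define \<delta> where "\<delta> = \<epsilon> / (e1 + e2)"
  have \<delta>: "\<delta> > 0" "(e1 + e2) * \<delta> = \<epsilon>" using assms by (auto simp: \<delta>_def field_simps)
  obtain m0 where m0: "\<And>S. finite S \<Longrightarrow> S \<subseteq> {m0..} \<Longrightarrow> (\<Sum>k\<in>S. \<bar>\<omega> \<beta> k\<bar>) \<le> \<delta>"
    using finite_tail_small[OF summable_\<omega>[OF assms(3,4)] \<delta>(1)] by blast
  \<comment> \<open>With at least one row cut off at the top and at the bottom, the exceptional corner entries of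
    \<open>A0_mat - P_sk_mat\<close> fall into the low-rank part.\<close>
  define m where "m = Suc m0"
  have tail: "(\<Sum>k\<in>S. \<bar>\<omega> \<beta> k\<bar>) \<le> \<delta>" if "finite S" "S \<subseteq> {m..}" for S
    using that by (intro m0) (auto simp: m_def)
  show ?thesis
  \<comment> \<open>The rank is at most \<open>2 * m\<close>, and the bound on it is strict. Since \<open>m \<ge> 1\<close>, the choice \<open>m + 1\<close>
    also forces \<open>n \<ge> 3\<close>, so that the coefficients of index 0, 1 and 2 all occur.\<close>
  proof (intro exI[of _ "m + 1"] conjI allI impI)
    fix N :: nat assume N: "N \<ge> 3" "N - 1 > m + 1"
    define n where "n = N - 1"
    have Nn: "N = Suc n" and n: "n \<ge> 3" using N by (auto simp: n_def m_def)
    define h \<tau> where "h = L / real N" and "\<tau> = T / real (M N)"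
    define A P where "A = A0_mat \<alpha> \<beta> e1 e2 h \<tau> N" and "P = P_sk_mat \<alpha> \<beta> e1 e2 h \<tau> N"
    define \<mu> where "\<mu> = h powr \<beta> * c0 \<alpha> \<tau>"
    have \<mu>: "v < \<mu>" using assms(11)[OF N(1)] by (simp add: \<mu>_def h_def \<tau>_def)
    have P: "P \<in> carrier_mat n n" and A: "A \<in> carrier_mat n n"
      using n P_sk_carrier A0_carrier by (auto simp: P_def A_def Nn)
    have coercive: "\<mu> * (\<Sum>i<n. (x i)\<^sup>2) \<le> (\<Sum>i<n. \<Sum>j<n. P $$ (i, j) * x i * x j)" for x
      unfolding \<mu>_def P_def Nn using assms \<sigma> n by (intro P_sk_coercive) auto
    define S where "S = {..<m} \<union> {n - m..<n}"
    have mid: "{..<n} - S = {m..<n - m}" using N by (auto simp: S_def)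
    note bounds = A0_minus_P_sk_bounds[where m = m and n = n and \<alpha> = \<alpha> and \<beta> = \<beta> and ?e1.0 = e1
        and ?e2.0 = e2 and h = h and \<tau> = \<tau>, OF _ _ \<sigma> _ _ tail, folded Nn, unfolded \<delta>(2)]
    obtain Q U V where Q: "Q \<in> carrier_mat n n" "P * Q = 1\<^sub>m n" "Q * P = 1\<^sub>m n"
      and UV: "U \<in> carrier_mat n n" "V \<in> carrier_mat n n" "Q * A - 1\<^sub>m n = U + V"
      and rank: "vec_space.rank n U \<le> card S" and norm: "spectral_norm V \<le> \<epsilon> / \<mu>"
    proof (rule preconditioned_splitting[OF P A _ coercive])
      show "\<mu> > 0" using \<mu> assms by simp
      show "S \<subseteq> {..<n}" using N by (auto simp: S_def n_def)
      show "\<epsilon> \<ge> 0" using assms by simp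
      show "(\<Sum>j<n. \<bar>A $$ (i, j) - P $$ (i, j)\<bar>) \<le> \<epsilon>" if "i < n" "i \<notin> S" for i
        unfolding A_def P_def using bounds(1)[of i] assms n that by (auto simp: S_def m_def)
      show "(\<Sum>i\<in>{..<n} - S. \<bar>A $$ (i, j) - P $$ (i, j)\<bar>) \<le> \<epsilon>" if "j < n" for j
        unfolding mid A_def P_def using bounds(2)[of j] assms n that by (auto simp: m_def)
    qed
    have "card S \<le> m + m"
      unfolding S_def by (rule order_trans[OF card_Un_le]) auto
    with rank have "vec_space.rank n U < 2 * (m + 1)" by simp
    moreover have "\<epsilon> / \<mu> \<le> \<epsilon> / v"
      using \<mu> assms by (intro divide_left_mono) auto
    ultimately show "let h = L / real N; \<tau> = T / real (M N);
           A0 = A0_mat \<alpha> \<beta> e1 e2 h \<tau> N; P = P_sk_mat \<alpha> \<beta> e1 e2 h \<tau> N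
       in \<exists>Pinv U V.
            Pinv \<in> carrier_mat (N - 1) (N - 1) \<and> inverts_mat P Pinv \<and> inverts_mat Pinv P \<and>
            U \<in> carrier_mat (N - 1) (N - 1) \<and> V \<in> carrier_mat (N - 1) (N - 1) \<and>
            Pinv * A0 - 1\<^sub>m (N - 1) = U + V \<and>
            vec_space.rank (N - 1) U < 2 * (m + 1) \<and>
            spectral_norm V \<le> \<epsilon> / v"
      unfolding Let_def h_def[symmetric] \<tau>_def[symmetric] A_def[symmetric] P_def[symmetric]
        n_def[symmetric] inverts_mat_def
      using Q UV norm P by (intro exI[of _ Q] exI[of _ U] exI[of _ V]) auto
  qed simp
qed

end
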